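(* Let $A\in\mathcal{PC}_4$. The Perron vector of $A$ is inefficient for $A$ if and only if $A=D^{-1}BD$ for some $D\in\mathcal{D}_4$ and some $B\in\mathcal{S}_4$.
   Context: $\mathcal{PC}_n$ denotes the set of $n\times n$ reciprocal matrices, i.e. real matrices $A=[a_{ij}]$ with all entries positive and $a_{ji}=1/a_{ij}$ for all $i,j$ (so $a_{ii}=1$). The Perron vector of a positive square matrix is any entrywise positive (right) eigenvector (unique up to positive scalar multiple). A positive vector $w$ is efficient for $A\in\mathcal{PC}_n$ if, for every positive $n$-vector $v$, the inequalities $|a_{ij}-v_i/v_j|\le|a_{ij}-w_i/w_j|$ for all $i,j$ imply that $v$ is a positive scalar multiple of $w$; otherwise $w$ is inefficient for $A$. $\mathcal{D}_4$ is the set of $4\times4$ diagonal matrices with positive diagonal entries. $\mathcal{S}_4$ is the set of matrices in $\mathcal{PC}_4$ whose Perron vector is the all-ones vector $\mathbf{e}_4$ (that is, with constant row sums) and which have a row in which all the off-diagonal entries are greater than $1$. *)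

theory Defs
  imports "HOL-Analysis.Analysis"
begin

definition positive_vec :: "real ^ 'n \<Rightarrow> bool" where
  "positive_vec w \<longleftrightarrow> (\<forall>i. 0 < w $ i)"

definition reciprocal_matrices :: "(real ^ 'n ^ 'n) set" where
  "reciprocal_matrices =
     {A. (\<forall>i j. 0 < A $ i $ j) \<and> (\<forall>i j. A $ j $ i = 1 / A $ i $ j)}"

(* Determined only up to positive scaling, hence a predicate rather than a function.
   Since A and w are real and w is nonzero, the eigenvalue is necessarily real. *)
definition perron_vector :: "real ^ 'n ^ 'n \<Rightarrow> real ^ 'n \<Rightarrow> bool" where
  "perron_vector A w \<longleftrightarrow> positive_vec w \<and> (\<exists>c::real. A *v w = c *\<^sub>R w)"

definition efficient :: "real ^ 'n ^ 'n \<Rightarrow> real ^ 'n \<Rightarrow> bool" where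
  "efficient A w \<longleftrightarrow> positive_vec w \<and>
     (\<forall>v. positive_vec v \<longrightarrow>
        (\<forall>i j. \<bar>A $ i $ j - v $ i / v $ j\<bar> \<le> \<bar>A $ i $ j - w $ i / w $ j\<bar>) \<longrightarrow>
        (\<exists>c>0. v = c *\<^sub>R w))"

definition inefficient :: "real ^ 'n ^ 'n \<Rightarrow> real ^ 'n \<Rightarrow> bool" where
  "inefficient A w \<longleftrightarrow> positive_vec w \<and> \<not> efficient A w"

definition positive_diagonal_matrices :: "(real ^ 'n ^ 'n) set" where
  "positive_diagonal_matrices =
     {D. (\<forall>i. 0 < D $ i $ i) \<and> (\<forall>i j. i \<noteq> j \<longrightarrow> D $ i $ j = 0)}"

definition S4 :: "(real ^ 4 ^ 4) set" where
  "S4 = {B \<in> reciprocal_matrices. perron_vector B (\<chi> i. 1) \<and>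
           (\<exists>i. \<forall>j. j \<noteq> i \<longrightarrow> 1 < B $ i $ j)}"

end

theory Submission
  imports Defs
begin

text \<open>
  Conjugating by a positive diagonal matrix changes neither the eigenvalues nor, after the matching
  change of the vector, efficiency: the errors \<open>a_ij - v_i / v_j\<close> are multiplied by positive factors
  that do not depend on \<open>v\<close> (\<open>perron_vector_rescale\<close>, \<open>efficient_rescale\<close>). One may therefore
  conjugate the Perron vector to the all-ones vector, and the question becomes when a reciprocal
  matrix \<open>B\<close> of order 4 with constant row sums has an inefficient all-ones vector.

  If \<open>v\<close> shows inefficiency, let \<open>S\<close> be the set of indices where \<open>v\<close> is largest. For \<open>i\<close> in \<open>S\<close> and
  \<open>j\<close> outside, the ratio \<open>v_i / v_j\<close> exceeds 1 and is at least as good an approximation of \<open>b_ij\<close> as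
  1 is, so \<open>b_ij > 1\<close> (\<open>dominating_set_of_inefficient\<close>). Thus \<open>S\<close> dominates its complement. The
  common row sum is at least 4, because \<open>b_ij + b_ji \<ge> 2\<close>. If the complement had one or two elements,
  one of its rows would be at most 1 within the complement and below 1 on \<open>S\<close>, hence have a sum
  below 4 (\<open>dominating_set_small_complement\<close>). So \<open>S\<close> is a single index, whose row is the row
  required by \<open>S4\<close>.

  Conversely, if all off-diagonal entries of row \<open>i\<close> exceed 1, a suitable increase of the \<open>i\<close>-th
  coordinate of a constant vector improves its ratios to the others and leaves the remaining ones
  alone (\<open>inefficient_of_dominating_row\<close>). Carrying this back to \<open>A\<close> uses the uniqueness of the
  Perron vector (\<open>perron_vector_constant\<close>).
\<close>

section \<open>Conjugation by a positive diagonal matrix\<close>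

definition rescale :: "real ^ 'n \<Rightarrow> real ^ 'n ^ 'n \<Rightarrow> real ^ 'n ^ 'n" where
  "rescale d A = (\<chi> i j. A $ i $ j * d $ j / d $ i)"

lemma rescale_nth [simp]: "rescale d A $ i $ j = A $ i $ j * d $ j / d $ i"
  by (simp add: rescale_def)

lemma diagonal_similarity_eq_rescale:
  fixes D B :: "real ^ 'n ^ 'n"
  assumes "D \<in> positive_diagonal_matrices"
  shows "matrix_inv D ** B ** D = rescale (\<chi> i. D $ i $ i) B"
proof -
  have pos: "\<And>i. 0 < D $ i $ i" and off: "\<And>i j. i \<noteq> j \<Longrightarrow> D $ i $ j = 0"
    using assms by (auto simp: positive_diagonal_matrices_def)
  define E :: "real ^ 'n ^ 'n" where "E = (\<chi> i j. if i = j then 1 / D $ i $ i else 0)"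
  have D_eq: "D $ i $ j = (if i = j then D $ i $ i else 0)" for i j
    using off by auto
  have mult_D: "(X ** D) $ i $ j = X $ i $ j * D $ j $ j" for X :: "real ^ 'n ^ 'n" and i j
    unfolding matrix_matrix_mult_def
    by (subst D_eq) (simp add: if_distrib cong: if_cong)
  have mult_E: "(E ** X) $ i $ j = X $ i $ j / D $ i $ i" for X :: "real ^ 'n ^ 'n" and i j
    by (simp add: matrix_matrix_mult_def E_def if_distrib if_distribR cong: if_cong)
  have E_nth: "E $ i $ j = (if i = j then 1 / D $ i $ i else 0)" for i j
    by (simp add: E_def)
  have "E ** D = mat 1"
    using pos by (auto simp: vec_eq_iff mult_D mat_def E_nth order_less_imp_not_eq2)
  then have inverse: "E ** D = mat 1" "D ** E = mat 1"
    using matrix_left_right_inverse by blast+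
  have "D ** matrix_inv D = mat 1"
    unfolding matrix_inv_def
    by (rule someI2[of _ E "\<lambda>X. D ** X = mat 1"]) (use inverse in auto)
  then have inv_eq: "matrix_inv D = E"
    using inverse by (metis matrix_mul_assoc matrix_mul_lid matrix_mul_rid)
  show ?thesis
    by (simp add: inv_eq vec_eq_iff mult_D mult_E)
qed

lemma reciprocal_matricesD:
  assumes "A \<in> reciprocal_matrices"
  shows "0 < A $ i $ j" and "A $ j $ i = 1 / A $ i $ j"
  using assms unfolding reciprocal_matrices_def by blast+

lemma rescale_reciprocal:
  fixes A :: "real ^ 'n ^ 'n"
  assumes "A \<in> reciprocal_matrices" and "positive_vec d"
  shows "rescale d A \<in> reciprocal_matrices"
proof -
  note pos = reciprocal_matricesD(1)[OF assms(1)]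
  have d: "\<And>i. 0 < d $ i"
    using assms(2) by (simp add: positive_vec_def)
  have "0 < rescale d A $ i $ j" for i j
    using pos d by simp
  moreover have "rescale d A $ j $ i = 1 / rescale d A $ i $ j" for i j
    unfolding rescale_nth by (subst reciprocal_matricesD(2)[OF assms(1), of j i]) simp
  ultimately show ?thesis
    unfolding reciprocal_matrices_def by blast
qed

lemma positive_vec_mult_iff:
  fixes d w :: "real ^ 'n"
  assumes "positive_vec d"
  shows "positive_vec (d * w) \<longleftrightarrow> positive_vec w"
proof -
  have "0 < d $ i" for i
    using assms by (simp add: positive_vec_def)
  then have "0 < d $ i * w $ i \<longleftrightarrow> 0 < w $ i" for i
    by (meson mult_pos_pos zero_less_mult_pos)
  then show ?thesis
    by (simp add: positive_vec_def)
qed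

lemma perron_vector_rescale:
  fixes A :: "real ^ 'n ^ 'n"
  assumes "positive_vec d"
  shows "perron_vector (rescale d A) w \<longleftrightarrow> perron_vector A (d * w)"
proof -
  have d: "\<And>i. d $ i > 0" using assms by (simp add: positive_vec_def)
  have "(rescale d A *v w) $ i = (A *v (d * w)) $ i / d $ i" for i
    by (simp add: matrix_vector_mult_def sum_divide_distrib mult.assoc)
  then have "(rescale d A *v w) $ i = c * w $ i \<longleftrightarrow> (A *v (d * w)) $ i = c * (d $ i * w $ i)"
    for c i
    using d[of i] by (simp add: field_simps)
  then have "rescale d A *v w = c *\<^sub>R w \<longleftrightarrow> A *v (d * w) = c *\<^sub>R (d * w)" for c
    by (simp add: vec_eq_iff)
  then show ?thesis
    by (simp add: perron_vector_def positive_vec_mult_iff[OF assms])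
qed

text \<open>
  The error of \<open>v\<close> at \<open>(i, j)\<close> for the conjugated matrix is the error of \<open>d * v\<close> for \<open>A\<close> times
  \<open>d_j / d_i\<close>. This factor cancels when two vectors are compared, and \<open>v \<mapsto> d * v\<close> is a bijection
  of the positive vectors that respects proportionality.
\<close>

lemma efficient_rescale:
  fixes A :: "real ^ 'n ^ 'n"
  assumes "positive_vec d"
  shows "efficient (rescale d A) w \<longleftrightarrow> efficient A (d * w)"
proof -
  have d: "\<And>i. d $ i > 0" using assms by (simp add: positive_vec_def)
  have err: "\<bar>rescale d A $ i $ j - v $ i / v $ j\<bar>
      = \<bar>A $ i $ j - (d * v) $ i / (d * v) $ j\<bar> * (d $ j / d $ i)" for v i j
  proof -
    have "rescale d A $ i $ j - v $ i / v $ j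
      = (A $ i $ j - (d * v) $ i / (d * v) $ j) * (d $ j / d $ i)"
      using d[of i] d[of j] by (cases "v $ j = 0") (simp_all add: field_simps)
    then show ?thesis
      using d[of i] d[of j] by (simp add: abs_mult)
  qed
  have le: "\<bar>rescale d A $ i $ j - v $ i / v $ j\<bar> \<le> \<bar>rescale d A $ i $ j - w $ i / w $ j\<bar>
    \<longleftrightarrow> \<bar>A $ i $ j - (d * v) $ i / (d * v) $ j\<bar> \<le> \<bar>A $ i $ j - (d * w) $ i / (d * w) $ j\<bar>"
    for v i j
    unfolding err using d[of i] d[of j] by (intro mult_le_cancel_right_pos) simp
  have multiple: "v = c *\<^sub>R w \<longleftrightarrow> d * v = c *\<^sub>R (d * w)" for v c
    using d by (simp add: vec_eq_iff field_simps order_less_imp_not_eq2)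
  have surj: "\<exists>v. u = d * v" for u
    using d by (intro exI[of _ "\<chi> i. u $ i / d $ i"])
      (simp add: vec_eq_iff order_less_imp_not_eq2)
  have "(\<forall>v. P (d * v)) \<longleftrightarrow> (\<forall>u. P u)" for P
    using surj by metis
  note this[of "\<lambda>u. positive_vec u \<longrightarrow>
        (\<forall>i j. \<bar>A $ i $ j - u $ i / u $ j\<bar> \<le> \<bar>A $ i $ j - (d * w) $ i / (d * w) $ j\<bar>) \<longrightarrow>
        (\<exists>c>0. u = c *\<^sub>R (d * w))"]
  then show ?thesis
    unfolding efficient_def le multiple by (simp only: positive_vec_mult_iff[OF assms])
qed

lemma inefficient_rescale:
  fixes A :: "real ^ 'n ^ 'n"
  assumes "positive_vec d"
  shows "inefficient (rescale d A) w \<longleftrightarrow> inefficient A (d * w)"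
  by (simp add: inefficient_def efficient_rescale[OF assms] positive_vec_mult_iff[OF assms])

section \<open>Constant row sums\<close>

lemma perron_vector_constant_row_sums:
  fixes B :: "real ^ 'n ^ 'n"
  assumes "perron_vector B (\<chi> i. 1)"
  obtains r where "\<And>i. (\<Sum>j\<in>UNIV. B $ i $ j) = r"
  using assms by (auto simp: perron_vector_def vec_eq_iff matrix_vector_mult_def)

lemma ex_greatest_entry:
  fixes u :: "real ^ 'n"
  shows "\<exists>p. \<forall>j. u $ j \<le> u $ p"
proof -
  have "Max (range (($) u)) \<in> range (($) u)"
    by (rule Max_in) auto
  then obtain p where "Max (range (($) u)) = u $ p"
    by blast
  then have "u $ j \<le> u $ p" for j
    by (metis Max_ge finite finite_imageI rangeI)
  then show ?thesis
    by blast
qed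

text \<open>
  Uniqueness of the Perron vector by a maximum principle. With \<open>B u = c u\<close> and row sums \<open>r\<close>, the
  weighted sum of the gaps \<open>u_i - u_j\<close> along row \<open>i\<close> is \<open>(r - c) u_i\<close>. At a smallest entry of \<open>u\<close> no
  gap is positive, so \<open>r \<le> c\<close>; at a largest entry no gap is negative, so \<open>r \<le> c\<close> forces them all to
  vanish.
\<close>

lemma perron_vector_constant:
  fixes B :: "real ^ 'n ^ 'n"
  assumes pos: "\<And>i j. 0 < B $ i $ j"
    and ones: "perron_vector B (\<chi> i. 1)"
    and u: "perron_vector B u"
  obtains c where "0 < c" and "u = (\<chi> i. c)"
proof -
  obtain r where r: "\<And>i. (\<Sum>j\<in>UNIV. B $ i $ j) = r"
    using perron_vector_constant_row_sums[OF ones] by blast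
  have u_pos: "\<And>i. 0 < u $ i" 
    using u by (simp add: perron_vector_def positive_vec_def)
  obtain c where "B *v u = c *\<^sub>R u"
    using u by (auto simp: perron_vector_def)
  then have c: "(\<Sum>j\<in>UNIV. B $ i $ j * u $ j) = c * u $ i" for i
    by (simp add: vec_eq_iff matrix_vector_mult_def)
  obtain p where p: "\<And>j. u $ j \<le> u $ p"
    using ex_greatest_entry by blast
  obtain q where q: "\<And>j. u $ q \<le> u $ j"
    using ex_greatest_entry[of "- u"] by auto
  have gap: "(\<Sum>j\<in>UNIV. B $ i $ j * (u $ i - u $ j)) = (r - c) * u $ i" for i
    by (simp add: right_diff_distrib sum_subtractf c flip: r[of i] sum_distrib_right)
       (simp add: left_diff_distrib)
  have "(\<Sum>j\<in>UNIV. B $ q $ j * (u $ q - u $ j)) \<le> 0"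
    using pos q by (intro sum_nonpos) (simp add: mult_le_0_iff less_imp_le)
  then have "r \<le> c"
    using u_pos[of q] by (simp add: gap mult_le_0_iff)
  then have gap_le_0: "(\<Sum>j\<in>UNIV. B $ p $ j * (u $ p - u $ j)) \<le> 0"
    using u_pos[of p] by (simp add: gap mult_le_0_iff)
  have nonneg: "\<And>j. 0 \<le> B $ p $ j * (u $ p - u $ j)"
    using pos p by (simp add: less_imp_le)
  have "B $ p $ j * (u $ p - u $ j) = 0" for j
    using gap_le_0 nonneg sum_nonneg_eq_0_iff[of UNIV "\<lambda>j. B $ p $ j * (u $ p - u $ j)"]
    by (simp add: antisym sum_nonneg)
  then have "u $ j = u $ p" for j
    using pos[of p j] by (metis eq_iff_diff_eq_0 mult_eq_0_iff order_less_irrefl)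
  then show ?thesis
    using that[of "u $ p"] u_pos by (simp add: vec_eq_iff)
qed

text \<open>
  Adding all entries of \<open>B\<close> to all entries of its transpose gives \<open>2 n r\<close>, while each of the \<open>n\<^sup>2\<close>
  pairs contributes \<open>x + 1 / x \<ge> 2\<close>.
\<close>

lemma reciprocal_row_sum_ge:
  fixes B :: "real ^ 'n ^ 'n"
  assumes rec: "B \<in> reciprocal_matrices" 
    and r: "\<And>i. (\<Sum>j\<in>UNIV. B $ i $ j) = r"
  shows "real CARD('n) \<le> r"
proof -
  note pos = reciprocal_matricesD(1)[OF rec] and inv = reciprocal_matricesD(2)[OF rec]
  have pair: "2 \<le> B $ i $ j + B $ j $ i" for i j
  proof -
    have "2 \<le> x + 1 / x" if "0 < x" for x :: real
      using that sum_squares_bound[of x 1] by (simp add: field_simps power2_eq_square)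
    then show ?thesis
      using pos inv[of j i] by simp
  qed
  have "2 * real CARD('n) * real CARD('n) = (\<Sum>i\<in>(UNIV::'n set). \<Sum>j\<in>(UNIV::'n set). 2)"
    by simp
  also have "\<dots> \<le> (\<Sum>i\<in>UNIV. \<Sum>j\<in>UNIV. B $ i $ j + B $ j $ i)"
    using pair by (intro sum_mono)
  also have "\<dots> = (\<Sum>i\<in>UNIV. \<Sum>j\<in>UNIV. B $ i $ j) + (\<Sum>j\<in>UNIV. \<Sum>i\<in>UNIV. B $ j $ i)"
    by (simp add: sum.distrib) (rule sum.swap)
  also have "\<dots> = 2 * real CARD('n) * r"
    by (simp add: r)
  finally show ?thesis
    by (simp add: zero_less_card_finite)
qed

lemma no_dominated_row:
  fixes B :: "real ^ 'n ^ 'n"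
  assumes "B \<in> reciprocal_matrices" and "perron_vector B (\<chi> i. 1)"
    and le: "\<And>j. B $ k $ j \<le> 1" 
  shows "\<not> B $ k $ i < 1"
proof
  assume "B $ k $ i < 1"
  then have "(\<Sum>j\<in>UNIV. B $ k $ j) < (\<Sum>j\<in>(UNIV::'n set). 1)"
    using le by (intro sum_strict_mono_ex1) auto
  moreover obtain r where "\<And>i. (\<Sum>j\<in>UNIV. B $ i $ j) = r"
    using perron_vector_constant_row_sums[OF assms(2)] by blast
  ultimately show False
    using reciprocal_row_sum_ge[OF assms(1)] by fastforce
qed

section \<open>Inefficiency of the all-ones vector\<close>

text \<open>
  The set is where an improving vector \<open>v\<close> is largest; it is not everything since \<open>v\<close> is not
  constant. If \<open>b_ij \<le> 1\<close>, a ratio \<open>v_i / v_j > 1\<close> would be farther from \<open>b_ij\<close> than 1 is.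
\<close>

lemma dominating_set_of_inefficient:
  fixes B :: "real ^ 'n ^ 'n"
  assumes "inefficient B (\<chi> i. 1)"
  obtains S where "S \<noteq> {}" and "S \<noteq> UNIV"
    and "\<And>i j. i \<in> S \<Longrightarrow> j \<notin> S \<Longrightarrow> 1 < B $ i $ j"
proof -
  obtain v :: "real ^ 'n" where v_pos: "\<And>i. 0 < v $ i" 
    and close: "\<And>i j. \<bar>B $ i $ j - v $ i / v $ j\<bar> \<le> \<bar>B $ i $ j - 1\<bar>"
    and not_prop: "\<And>c. 0 < c \<Longrightarrow> v \<noteq> c *\<^sub>R (\<chi> i. 1)"
    using assms by (auto simp: inefficient_def efficient_def positive_vec_def)
  define S where "S = {i. \<forall>j. v $ j \<le> v $ i}"
  have "S \<noteq> {}"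
    unfolding S_def using ex_greatest_entry[of v] by blast
  moreover have "S \<noteq> UNIV"
  proof
    assume "S = UNIV"
    then have "v = v $ undefined *\<^sub>R (\<chi> i. 1)"
      by (auto simp: S_def vec_eq_iff set_eq_iff intro: antisym)
    then show False
      using not_prop v_pos by blast
  qed
  moreover have "1 < B $ i $ j" if "i \<in> S" "j \<notin> S" for i j
  proof -
    have "v $ j < v $ i"
      using that by (auto simp: S_def not_le intro: less_le_trans)
    then have "1 < v $ i / v $ j"
      using v_pos by simp
    then show ?thesis
      using close[of i j] by linarith
  qed
  ultimately show ?thesis
    using that by blast
qed

text \<open>
  This is where small order matters. A complement of at most two elements always contains a \<open>p\<close>
  with \<open>b_pj \<le> 1\<close> for all \<open>j\<close> in the complement, since \<open>b_kl\<close> and \<open>b_lk\<close> are reciprocal; among three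
  elements the entries may be cyclic. Such a row \<open>p\<close> cannot reach the row sum \<open>n\<close>, because its
  entries on \<open>S\<close> lie below 1.
\<close>

lemma dominating_set_small_complement:
  fixes B :: "real ^ 'n ^ 'n"
  assumes rec: "B \<in> reciprocal_matrices" and ones: "perron_vector B (\<chi> i. 1)"
    and "S \<noteq> {}" and "S \<noteq> UNIV"
    and dom: "\<And>i j. i \<in> S \<Longrightarrow> j \<notin> S \<Longrightarrow> 1 < B $ i $ j"
  shows "2 < card (- S)"
proof (rule ccontr)
  assume card: "\<not> 2 < card (- S)"
  note inv = reciprocal_matricesD(2)[OF rec]
  have recip: "B $ i $ j \<le> 1 \<or> B $ j $ i \<le> 1" for i j
  proof (rule disjCI)
    assume "\<not> B $ j $ i \<le> 1"
    then show "B $ i $ j \<le> 1"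
      by (subst inv[of i j]) simp
  qed
  have diag: "B $ i $ i \<le> 1" for i
    using recip by blast
  \<comment> \<open>The indices \<open>k\<close> and \<open>l\<close> coincide when the complement is a singleton.\<close>
  obtain k l where kl: "- S = {k, l}"
  proof -
    have "card (- S) \<noteq> 0"
      using assms(4) by auto
    with card have "card (- S) = 1 \<or> card (- S) = 2"
      by linarith
    then show ?thesis
      using that by (metis card_1_singletonE card_2_iff insert_absorb2)
  qed
  then obtain p where p: "p \<notin> S" "\<And>j. j \<notin> S \<Longrightarrow> B $ p $ j \<le> 1"
    using recip[of k l] diag
    by (metis Compl_iff insert_iff order_refl singletonD)
  have lt: "B $ p $ j < 1" if "j \<in> S" for j
    using dom[OF that p(1)] by (subst inv[of p j]) simp
  have "B $ p $ j \<le> 1" for j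
    using lt p(2) by (cases "j \<in> S") (auto intro: less_imp_le)
  then show False
    using no_dominated_row[OF rec ones] lt assms(3) by blast
qed

text \<open>
  Multiplying coordinate \<open>i\<close> by the smallest off-diagonal entry \<open>m > 1\<close> of row \<open>i\<close> moves the ratios
  \<open>v_i / v_j\<close> from 1 up to \<open>m\<close>, towards \<open>b_ij\<close> without overshooting, and the inverse ratios from 1
  down to \<open>1 / m \<ge> b_ji\<close>. A second index is needed for the new vector not to be a multiple of the
  old one.
\<close>

lemma inefficient_of_dominating_row:
  fixes B :: "real ^ 'n ^ 'n"
  assumes rec: "B \<in> reciprocal_matrices" and "2 \<le> CARD('n)" and "0 < c"
    and dom: "\<And>j. j \<noteq> i \<Longrightarrow> 1 < B $ i $ j"
  shows "inefficient B (\<chi> i. c)"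
proof -
  note inv = reciprocal_matricesD(2)[OF rec]
  obtain k where k: "k \<noteq> i"
    using assms(2) by (metis (full_types) One_nat_def UNIV_I UNIV_eq_I card_1_singleton_iff
        insert_iff not_less_eq_eq numeral_2_eq_2 order_refl)
  define m where "m = Min (($) (B $ i) ` (- {i}))"
  have ne: "($) (B $ i) ` (- {i}) \<noteq> {}"
    using k by auto
  have m_gt: "1 < m"
    unfolding m_def using ne dom by (subst Min_gr_iff) auto
  have m_le: "m \<le> B $ i $ j" if "j \<noteq> i" for j
    unfolding m_def using that by (intro Min_le) auto
  define v :: "real ^ 'n" where "v = (\<chi> j. if j = i then c * m else c)"
  have "positive_vec v"
    using m_gt \<open>0 < c\<close> by (auto simp: v_def positive_vec_def)
  moreover have "\<bar>B $ p $ q - v $ p / v $ q\<bar>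
      \<le> \<bar>B $ p $ q - (\<chi> i. c) $ p / (\<chi> i. c) $ q\<bar>" for p q
  proof -
    consider "p = i" "q = i" | "p = i" "q \<noteq> i" | "p \<noteq> i" "q = i" | "p \<noteq> i" "q \<noteq> i"
      by blast
    then show ?thesis
    proof cases
      case 2
      then show ?thesis
        using m_gt m_le[of q] \<open>0 < c\<close> by (simp add: v_def)
    next
      case 3
      have "B $ p $ i \<le> 1 / m" "1 / m \<le> 1"
        using m_gt m_le[of p] 3 by (simp_all add: inv[of p i] frac_le)
      then show ?thesis
        using 3 \<open>0 < c\<close> by (simp add: v_def)
    qed (use m_gt \<open>0 < c\<close> in \<open>simp_all add: v_def\<close>)
  qed
  moreover have "v \<noteq> b *\<^sub>R (\<chi> i. c)" for b
  proof
    assume "v = b *\<^sub>R (\<chi> i. c)"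
    then have "v $ i = v $ k"
      by simp
    then show False
      using k m_gt \<open>0 < c\<close> by (simp add: v_def)
  qed
  ultimately have "\<not> efficient B (\<chi> i. c)"
    unfolding efficient_def by blast
  then show ?thesis
    using \<open>0 < c\<close> by (simp add: inefficient_def positive_vec_def)
qed

section \<open>Order four\<close>

theorem theorem30:
  fixes A :: "real ^ 4 ^ 4" and w :: "real ^ 4"
  assumes "A \<in> reciprocal_matrices"
    and "perron_vector A w"
  shows "inefficient A w \<longleftrightarrow>
    (\<exists>D \<in> positive_diagonal_matrices. \<exists>B \<in> S4. A = matrix_inv D ** B ** D)"
proof
  assume ineff: "inefficient A w"
  have w: "positive_vec w"
    using assms(2) by (simp add: perron_vector_def)
  then have w_nz: "\<And>i. w $ i \<noteq> 0"
    by (metis order_less_irrefl positive_vec_def)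
  have w_ones: "w * (\<chi> i. 1) = w"
    by (simp add: vec_eq_iff)
  define B where "B = rescale w A"
  have rec: "B \<in> reciprocal_matrices"
    unfolding B_def using assms(1) w by (rule rescale_reciprocal)
  have ones: "perron_vector B (\<chi> i. 1)"
    unfolding B_def perron_vector_rescale[OF w] w_ones by (rule assms(2))
  have "inefficient B (\<chi> i. 1)"
    unfolding B_def inefficient_rescale[OF w] w_ones by (rule ineff)
  then obtain S where S: "S \<noteq> {}" "S \<noteq> UNIV"
    and dom: "\<And>i j. i \<in> S \<Longrightarrow> j \<notin> S \<Longrightarrow> 1 < B $ i $ j"
    using dominating_set_of_inefficient by blast
  have "2 < card (- S)"
    using dominating_set_small_complement[OF rec ones S dom] .
  moreover have "card S + card (- S) = 4"
    using card_Un_disjoint[of S "- S"] by simp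
  moreover have "card S \<noteq> 0"
    using S(1) by simp
  ultimately have "card S = 1"
    by linarith
  then obtain i where "S = {i}"
    by (rule card_1_singletonE)
  then have "B \<in> S4"
    using rec ones dom by (auto simp: S4_def)
  moreover define D :: "real ^ 4 ^ 4" where "D = (\<chi> i j. if i = j then 1 / w $ i else 0)"
  have D: "D \<in> positive_diagonal_matrices"
    using w by (simp add: D_def positive_diagonal_matrices_def positive_vec_def)
  moreover have "A = matrix_inv D ** B ** D"
    unfolding diagonal_similarity_eq_rescale[OF D] using w_nz
    by (simp add: vec_eq_iff B_def D_def)
  ultimately show "\<exists>D \<in> positive_diagonal_matrices. \<exists>B \<in> S4. A = matrix_inv D ** B ** D"
    by blast
next
  assume "\<exists>D \<in> positive_diagonal_matrices. \<exists>B \<in> S4. A = matrix_inv D ** B ** D"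
  then obtain D B where D: "D \<in> positive_diagonal_matrices" and B: "B \<in> S4"
    and A: "A = matrix_inv D ** B ** D"
    by blast
  define d :: "real ^ 4" where "d = (\<chi> i. D $ i $ i)"
  have d: "positive_vec d"
    using D by (simp add: d_def positive_diagonal_matrices_def positive_vec_def)
  have A_eq: "A = rescale d B"
    unfolding A d_def by (rule diagonal_similarity_eq_rescale[OF D])
  obtain i where dom: "\<And>j. j \<noteq> i \<Longrightarrow> 1 < B $ i $ j"
    and rec: "B \<in> reciprocal_matrices" and ones: "perron_vector B (\<chi> i. 1)"
    using B by (auto simp: S4_def)
  note reciprocal_matricesD(1)[OF rec]
  moreover have "perron_vector B (d * w)"
    using assms(2) unfolding A_eq perron_vector_rescale[OF d] .
  ultimately obtain c where "0 < c" "d * w = (\<chi> i. c)"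
    using ones perron_vector_constant by blast
  then show "inefficient A w"
    unfolding A_eq inefficient_rescale[OF d]
    using inefficient_of_dominating_row[OF rec _ _ dom] by simp
qed

end
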